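(* Let $D_n\subset \mathrm{SO}(3)$ be the dihedral rotation group and let $n$ be odd. Then $X(D_n,D_n)\cong \mathbb{R}P^3$ (homeomorphism).
   Context: For finite subgroups $G_1,G_2\subset \mathrm{SO}(3)$, the misorientation space is the topological orbit space $X(G_1,G_2)=\mathrm{SO}(3)/(G_1\times G_2)=G_1\backslash \mathrm{SO}(3)/G_2$, where $(g_1,g_2)\cdot A=g_1Ag_2^{-1}$. The dihedral rotation group $D_n$ (order $2n$) is generated by an axial rotation of order $n$ and a rotation of order $2$ about an axis orthogonal to the first axis. *)

theory Defs
  imports "HOL-Analysis.Analysis" "HOL-Algebra.Multiplicative_Group"
    "HOL-Algebra.Generated_Groups" "HOL-Algebra.Group_Action"
begin

section \<open>Quotient topology induced by a map\<close>

definition quotient_topology :: "'a topology \<Rightarrow> ('a \<Rightarrow> 'b) \<Rightarrow> 'b topology" where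
  "quotient_topology X f =
     topology (\<lambda>U. U \<subseteq> f ` topspace X \<and> openin X {x \<in> topspace X. f x \<in> U})"

lemma openin_quotient_topology:
  "openin (quotient_topology X f) U \<longleftrightarrow>
     U \<subseteq> f ` topspace X \<and> openin X {x \<in> topspace X. f x \<in> U}"
proof -
  have "istopology (\<lambda>U. U \<subseteq> f ` topspace X \<and> openin X {x \<in> topspace X. f x \<in> U})"
    unfolding istopology_def
  proof (intro conjI allI impI)
    fix S T
    assume S: "S \<subseteq> f ` topspace X \<and> openin X {x \<in> topspace X. f x \<in> S}"
      and T: "T \<subseteq> f ` topspace X \<and> openin X {x \<in> topspace X. f x \<in> T}"
    have "{x \<in> topspace X. f x \<in> S \<inter> T}
        = {x \<in> topspace X. f x \<in> S} \<inter> {x \<in> topspace X. f x \<in> T}" by auto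
    then show "openin X {x \<in> topspace X. f x \<in> S \<inter> T}"
      using S T by (simp only: openin_Int)
    show "S \<inter> T \<subseteq> f ` topspace X" using S by blast
  next
    fix K
    assume K: "\<forall>S\<in>K. S \<subseteq> f ` topspace X \<and> openin X {x \<in> topspace X. f x \<in> S}"
    have "{x \<in> topspace X. f x \<in> \<Union>K} = (\<Union>S\<in>K. {x \<in> topspace X. f x \<in> S})" by auto
    moreover have "openin X (\<Union>S\<in>K. {x \<in> topspace X. f x \<in> S})"
      using K by (intro openin_Union) auto
    ultimately show "openin X {x \<in> topspace X. f x \<in> \<Union>K}" by simp
    show "\<Union>K \<subseteq> f ` topspace X" using K by blast
  qed
  from topology_inverse'[OF this] show ?thesis
    by (simp only: quotient_topology_def)
qed

lemma topspace_quotient_topology [simp]: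
  "topspace (quotient_topology X f) = f ` topspace X"
proof
  show "topspace (quotient_topology X f) \<subseteq> f ` topspace X"
    using openin_topspace[of "quotient_topology X f"] unfolding openin_quotient_topology by (rule conjunct1)
  have "{x \<in> topspace X. f x \<in> f ` topspace X} = topspace X" by blast
  then have "openin (quotient_topology X f) (f ` topspace X)"
    by (simp add: openin_quotient_topology)
  then show "f ` topspace X \<subseteq> topspace (quotient_topology X f)"
    by (rule openin_subset)
qed

lemma quotient_map_quotient_topology: "quotient_map X (quotient_topology X f) f"
  by (auto simp: quotient_map_def openin_quotient_topology)


section \<open>The group SO(3) and its dihedral subgroups\<close>

definition SO3 :: "(real^3^3) monoid" where
  "SO3 = \<lparr>carrier = {A. rotation_matrix A}, mult = (**), one = mat 1\<rparr>"

lemma SO3_simps [simp]: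
  "A \<in> carrier SO3 \<longleftrightarrow> rotation_matrix A" "A \<otimes>\<^bsub>SO3\<^esub> B = A ** B" "\<one>\<^bsub>SO3\<^esub> = mat 1"
  by (simp_all add: SO3_def)

lemma group_SO3: "group SO3"
proof (rule groupI)
  fix A assume A: "A \<in> carrier SO3"
  then have "rotation_matrix (transpose A)"
    by (simp add: rotation_matrix_def orthogonal_matrix_def)
  moreover have "transpose A ** A = mat 1"
    using A by (simp add: rotation_matrix_def orthogonal_matrix_def)
  ultimately show "\<exists>B\<in>carrier SO3. B \<otimes>\<^bsub>SO3\<^esub> A = \<one>\<^bsub>SO3\<^esub>"
    by (intro bexI[of _ "transpose A"]) simp_all
next
  fix A B C assume "A \<in> carrier SO3" "B \<in> carrier SO3" "C \<in> carrier SO3"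
  show "A \<otimes>\<^bsub>SO3\<^esub> B \<otimes>\<^bsub>SO3\<^esub> C = A \<otimes>\<^bsub>SO3\<^esub> (B \<otimes>\<^bsub>SO3\<^esub> C)"
    by (simp add: matrix_mul_assoc)
qed (simp_all add: rotation_matrix_def orthogonal_matrix_mul orthogonal_matrix_id det_mul)

(* The identity is a rotation about every axis; it is the axial rotation of order 1. *)
definition rotation_about :: "real^3 \<Rightarrow> real^3^3 \<Rightarrow> bool" where
  "rotation_about u A \<longleftrightarrow> u \<noteq> 0 \<and> A \<in> carrier SO3 \<and> A *v u = u"

(* D_n is determined only up to the choice of the two axes (that is, up to conjugacy in SO(3)),
   so this is a predicate on subgroups. group.ord is 0 for elements of infinite order. *)
definition dihedral_rotation_group :: "nat \<Rightarrow> (real^3^3) set \<Rightarrow> bool" where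
  "dihedral_rotation_group n D \<longleftrightarrow> 0 < n \<and>
     (\<exists>u v r s. orthogonal u v
        \<and> rotation_about u r \<and> group.ord SO3 r = n
        \<and> rotation_about v s \<and> group.ord SO3 s = 2
        \<and> D = generate SO3 {r, s})"

lemma dihedral_rotation_group_subgroup:
  assumes "dihedral_rotation_group n D"
  shows "subgroup D SO3"
  using assms group.generate_is_subgroup[OF group_SO3]
  by (auto simp: dihedral_rotation_group_def rotation_about_def)


section \<open>Misorientation spaces\<close>

abbreviation SO3_subgroup_prod ::
    "(real^3^3) set \<Rightarrow> (real^3^3) set \<Rightarrow> ((real^3^3) \<times> (real^3^3)) monoid" where
  "SO3_subgroup_prod G1 G2 \<equiv> SO3\<lparr>carrier := G1\<rparr> \<times>\<times> SO3\<lparr>carrier := G2\<rparr>"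

definition misorientation_action :: "(real^3^3) \<times> (real^3^3) \<Rightarrow> real^3^3 \<Rightarrow> real^3^3" where
  "misorientation_action = (\<lambda>(g1, g2). \<lambda>A\<in>carrier SO3. g1 \<otimes>\<^bsub>SO3\<^esub> A \<otimes>\<^bsub>SO3\<^esub> inv\<^bsub>SO3\<^esub> g2)"

lemma group_action_misorientation:
  assumes G1: "subgroup G1 SO3" and G2: "subgroup G2 SO3"
  shows "group_action (SO3_subgroup_prod G1 G2) (carrier SO3) misorientation_action"
proof -
  interpret S: group SO3 by (rule group_SO3)
  let ?P = "SO3_subgroup_prod G1 G2"
  have P: "group ?P"
    using S.subgroup_imp_group[OF G1] S.subgroup_imp_group[OF G2] by (rule DirProd_group)
  have mem: "fst g \<in> carrier SO3" "snd g \<in> carrier SO3" if "g \<in> carrier ?P" for g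
    using that subgroup.subset[OF G1] subgroup.subset[OF G2] by (auto simp del: SO3_simps)
  have clos: "a \<otimes>\<^bsub>SO3\<^esub> A \<otimes>\<^bsub>SO3\<^esub> inv\<^bsub>SO3\<^esub> b \<in> carrier SO3"
    if "a \<in> carrier SO3" "b \<in> carrier SO3" "A \<in> carrier SO3" for a b A
    using that by (simp del: SO3_simps)
  have inv: "inv\<^bsub>SO3\<^esub> a \<otimes>\<^bsub>SO3\<^esub> (a \<otimes>\<^bsub>SO3\<^esub> A \<otimes>\<^bsub>SO3\<^esub> inv\<^bsub>SO3\<^esub> b) \<otimes>\<^bsub>SO3\<^esub> b = A"
    if "a \<in> carrier SO3" "b \<in> carrier SO3" "A \<in> carrier SO3" for a b A
    using that by (simp add: S.m_assoc S.inv_solve_left' del: SO3_simps)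
  have bij: "misorientation_action g \<in> Bij (carrier SO3)" if g: "g \<in> carrier ?P" for g
  proof -
    obtain a b where ab: "g = (a, b)" by (cases g)
    have a: "a \<in> carrier SO3" and b: "b \<in> carrier SO3" using mem[OF g] ab by (simp_all del: SO3_simps)
    have "bij_betw (\<lambda>A. a \<otimes>\<^bsub>SO3\<^esub> A \<otimes>\<^bsub>SO3\<^esub> inv\<^bsub>SO3\<^esub> b) (carrier SO3) (carrier SO3)"
    proof (rule bij_betw_byWitness[where f' = "\<lambda>A. inv\<^bsub>SO3\<^esub> a \<otimes>\<^bsub>SO3\<^esub> A \<otimes>\<^bsub>SO3\<^esub> b"])
      show "\<forall>A\<in>carrier SO3. inv\<^bsub>SO3\<^esub> a \<otimes>\<^bsub>SO3\<^esub> (a \<otimes>\<^bsub>SO3\<^esub> A \<otimes>\<^bsub>SO3\<^esub> inv\<^bsub>SO3\<^esub> b) \<otimes>\<^bsub>SO3\<^esub> b = A"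
        using inv[OF a b] by blast
      show "\<forall>A\<in>carrier SO3. a \<otimes>\<^bsub>SO3\<^esub> (inv\<^bsub>SO3\<^esub> a \<otimes>\<^bsub>SO3\<^esub> A \<otimes>\<^bsub>SO3\<^esub> b) \<otimes>\<^bsub>SO3\<^esub> inv\<^bsub>SO3\<^esub> b = A"
        using inv[OF S.inv_closed[OF a] S.inv_closed[OF b]]
        unfolding S.inv_inv[OF a] S.inv_inv[OF b] by blast
      show "(\<lambda>A. a \<otimes>\<^bsub>SO3\<^esub> A \<otimes>\<^bsub>SO3\<^esub> inv\<^bsub>SO3\<^esub> b) ` carrier SO3 \<subseteq> carrier SO3"
        using clos[OF a b] by blast
      show "(\<lambda>A. inv\<^bsub>SO3\<^esub> a \<otimes>\<^bsub>SO3\<^esub> A \<otimes>\<^bsub>SO3\<^esub> b) ` carrier SO3 \<subseteq> carrier SO3"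
        using a b by (blast intro: S.m_closed S.inv_closed)
    qed
    then show ?thesis
      unfolding Bij_def misorientation_action_def ab
      by (simp add: bij_betw_restrict_eq del: SO3_simps)
  qed
  have mul: "misorientation_action (g \<otimes>\<^bsub>?P\<^esub> h)
      = misorientation_action g \<otimes>\<^bsub>BijGroup (carrier SO3)\<^esub> misorientation_action h"
    if g: "g \<in> carrier ?P" and h: "h \<in> carrier ?P" for g h
  proof -
    obtain a b c d where gh: "g = (a, b)" "h = (c, d)" by (cases g; cases h)
    have c: "a \<in> carrier SO3" "b \<in> carrier SO3" "c \<in> carrier SO3" "d \<in> carrier SO3"
      using mem[OF g] mem[OF h] gh by (simp_all del: SO3_simps)
    have "misorientation_action g \<otimes>\<^bsub>BijGroup (carrier SO3)\<^esub> misorientation_action h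
        = compose (carrier SO3) (misorientation_action g) (misorientation_action h)"
      using bij[OF g] bij[OF h] by (simp add: BijGroup_def del: SO3_simps)
    also have "\<dots> = misorientation_action (g \<otimes>\<^bsub>?P\<^esub> h)"
    proof
      fix A
      show "compose (carrier SO3) (misorientation_action g) (misorientation_action h) A
          = misorientation_action (g \<otimes>\<^bsub>?P\<^esub> h) A"
      proof (cases "A \<in> carrier SO3")
        case True
        then show ?thesis
          using c clos[OF c(3,4) True]
          by (simp add: compose_def misorientation_action_def gh S.inv_mult_group S.m_assoc
              del: SO3_simps)
      qed (simp add: compose_def misorientation_action_def gh del: SO3_simps)
    qed
    finally show ?thesis ..
  qed
  have "misorientation_action \<in> hom ?P (BijGroup (carrier SO3))"
    using bij mul by (intro homI) (simp_all add: BijGroup_def)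
  then show ?thesis
    by (intro group_action.intro group_hom.intro group_hom_axioms.intro P group_BijGroup)
qed

(* The points are the orbits, i.e. the double cosets G1 A G2; SO(3) carries the subspace
   topology of the real 3x3 matrices. *)
definition misorientation_space ::
    "(real^3^3) set \<Rightarrow> (real^3^3) set \<Rightarrow> (real^3^3) set topology" where
  "misorientation_space G1 G2 =
     quotient_topology (top_of_set (carrier SO3))
       (orbit (SO3_subgroup_prod G1 G2) misorientation_action)"

lemma topspace_misorientation_space:
  "topspace (misorientation_space G1 G2)
     = orbits (SO3_subgroup_prod G1 G2) (carrier SO3) misorientation_action"
  by (auto simp: misorientation_space_def orbits_def)


section \<open>Real projective 3-space\<close>

(* The space of lines through the origin of R^4, a quotient of R^4 - {0}. *)
definition RP3 :: "(real^4) set topology" where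
  "RP3 = quotient_topology (top_of_set (- {0})) (\<lambda>x. span {x})"

end

theory Submission
  imports Defs
begin

text \<open>
Both spaces are quotients of the unit sphere of the quaternions by the same equivalence relation.

The sphere covers the rotation group twice. In a frame adapted to the two axes, the dihedral group
lifts to the binary dihedral group \<open>\<Gamma>\<close> of the quaternions \<open>c\<close> and \<open>c j\<close>
with \<open>c ^ (2 * n) = 1\<close> (\<open>dihedral_rotation_group_eq_framed_rot\<close>), so the misorientation space
is the space of double cosets \<open>\<Gamma> x \<Gamma>\<close> in the sphere (\<open>orbit_framed_rot_eq_iff\<close>).

These double cosets have an explicit invariant. Write \<open>x = z + w j\<close> with complex \<open>z\<close> and \<open>w\<close>.
Because \<open>n\<close> is odd, the rotations about the main axis, applied on both sides, multiply \<open>z\<close> and \<open>w\<close>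
by arbitrary independent \<open>n\<close>-th roots of unity and by common signs, so only \<open>Z = z^n\<close> and \<open>W = w^n\<close>
matter. This reduces everything to the group generated by \<open>j\<close>. Put \<open>P = Re Z + i Re W\<close> and
\<open>R = Im Z + i Im W\<close>. Left and right multiplication by \<open>j\<close> act on \<open>(P, R)\<close> as multiplication by
\<open>(i, -i)\<close> and \<open>(i, i)\<close>; they change \<open>(P\<^sup>2, R\<^sup>2)\<close> by the sign \<open>-1\<close>, and conversely \<open>(P\<^sup>2, R\<^sup>2)\<close> up to sign
determines \<open>(P, R)\<close> up to this group. So the line spanned by \<open>(P\<^sup>2, R\<^sup>2)\<close> in the real four-space of
pairs of complex numbers is a complete invariant (\<open>double_coset_inv_eq_iff\<close>), and every line occurs
(\<open>double_coset_inv_onto_lines\<close>).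

Thus the sphere maps continuously onto the misorientation space and onto projective space with the
same fibres. The sphere is compact, and the rotation group and projective space
(\<open>Hausdorff_space_RP3\<close>) are Hausdorff, so both are quotient maps, and quotients with the same
fibres are homeomorphic (\<open>homeomorphic_space_of_quotient_maps\<close>).
\<close>

section \<open>Quotient maps and projective space\<close>

text \<open>Each of the two quotient maps factors through the other, and the two induced maps are inverse to
each other because they are so on the image of a common point.\<close>

lemma homeomorphic_space_of_quotient_maps:
  assumes f: "quotient_map X Y f" and g: "quotient_map X Z g"
    and fibres: "\<And>x y. x \<in> topspace X \<Longrightarrow> y \<in> topspace X \<Longrightarrow> f x = f y \<longleftrightarrow> g x = g y"
  shows "Y homeomorphic_space Z"
proof -
  obtain h where h: "continuous_map Y Z h" "\<And>x. x \<in> topspace X \<Longrightarrow> h (f x) = g x"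
    using quotient_map_lift_exists[OF f quotient_imp_continuous_map[OF g]] fibres by metis
  obtain k where k: "continuous_map Z Y k" "\<And>x. x \<in> topspace X \<Longrightarrow> k (g x) = f x"
    using quotient_map_lift_exists[OF g quotient_imp_continuous_map[OF f]] fibres by metis
  have "homeomorphic_maps Y Z h k"
    unfolding homeomorphic_maps_def
    using h k quotient_imp_surjective_map[OF f, symmetric] quotient_imp_surjective_map[OF g, symmetric]
    by auto
  then show ?thesis
    by (auto simp: homeomorphic_space_def)
qed

lemma span_singleton_eq_iff:
  fixes x y :: "'a::real_vector"
  assumes "x \<noteq> 0" "y \<noteq> 0"
  shows "span {x} = span {y} \<longleftrightarrow> (\<exists>c. c \<noteq> 0 \<and> y = c *\<^sub>R x)"
proof
  assume "span {x} = span {y}"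
  then have "y \<in> span {x}"
    by (simp add: span_base)
  then show "\<exists>c. c \<noteq> 0 \<and> y = c *\<^sub>R x"
    using assms by (auto simp: span_singleton)
next
  assume "\<exists>c. c \<noteq> 0 \<and> y = c *\<^sub>R x"
  then obtain c where c: "c \<noteq> 0" "y = c *\<^sub>R x" by blast
  then have "y \<in> span {x}" "x \<in> span {y}"
    using span_scale[OF span_base, of y "{y}" "1 / c"] by (simp_all add: span_base span_scale)
  then show "span {x} = span {y}"
    by (intro equalityI span_minimal) auto
qed

text \<open>The matrix \<open>x x\<^sup>T / |x|\<^sup>2\<close> of the orthogonal projection onto the line through \<open>x\<close>. It depends
continuously on \<open>x\<close> and determines the line, so it realises projective space inside a space of
matrices.\<close>

definition line_projector :: "real^4 \<Rightarrow> real^4^4" where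
  "line_projector x = (\<chi> i j. x $ i * x $ j / (x \<bullet> x))"

lemma line_projector_mult: "line_projector x *v y = ((x \<bullet> y) / (x \<bullet> x)) *\<^sub>R x"
proof -
  have "(line_projector x *v y) $ i = (((x \<bullet> y) / (x \<bullet> x)) *\<^sub>R x) $ i" for i
  proof -
    have "(line_projector x *v y) $ i = (\<Sum>j\<in>UNIV. x $ i * x $ j / (x \<bullet> x) * y $ j)"
      by (simp add: line_projector_def matrix_vector_mult_def)
    also have "\<dots> = (\<Sum>j\<in>UNIV. x $ j * y $ j) * (x $ i / (x \<bullet> x))"
      unfolding sum_distrib_right by (intro sum.cong) (simp_all add: ac_simps)
    also have "(\<Sum>j\<in>UNIV. x $ j * y $ j) = x \<bullet> y"
      by (simp add: inner_vec_def)
    finally show ?thesis by simp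
  qed
  then show ?thesis by (simp add: vec_eq_iff)
qed

lemma line_projector_scaleR:
  assumes "c \<noteq> 0" shows "line_projector (c *\<^sub>R x) = line_projector x"
  using assms by (simp add: line_projector_def)

text \<open>The projector descends to an injective continuous map from projective space into the Hausdorff
space of matrices. A line is recovered from its projector as the set of fixed vectors.\<close>

lemma Hausdorff_space_RP3: "Hausdorff_space RP3"
proof -
  have q: "quotient_map (top_of_set (- {0})) RP3 (\<lambda>x::real^4. span {x})"
    unfolding RP3_def by (rule quotient_map_quotient_topology)
  have cont: "continuous_map (top_of_set (- {0})) euclidean line_projector"
    unfolding continuous_map_iff_continuous line_projector_def
    by (intro continuous_on_vec_lambda continuous_intros) auto
  have inv: "line_projector x = line_projector y"
    if "x \<in> topspace (top_of_set (- {0}))" "y \<in> topspace (top_of_set (- {0}))" "span {x} = span {y}"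
    for x y
  proof -
    have "\<exists>c. c \<noteq> 0 \<and> y = c *\<^sub>R x"
      using that by (subst span_singleton_eq_iff[symmetric]) simp_all
    then obtain c where "c \<noteq> 0" "y = c *\<^sub>R x" by blast
    then show ?thesis by (simp add: line_projector_scaleR)
  qed
  obtain g where cont_g: "continuous_map RP3 euclidean g"
    and g0: "\<And>x. x \<in> topspace (top_of_set (- {0})) \<Longrightarrow> g (span {x}) = line_projector x"
  proof (rule quotient_map_lift_exists[OF q cont])
    show "line_projector x = line_projector y"
      if "x \<in> topspace (top_of_set (- {0}))" "y \<in> topspace (top_of_set (- {0}))" "span {x} = span {y}"
      for x y
      by (rule inv[OF that])
  qed (rule that)
  have g: "g (span {x}) = line_projector x" if "x \<noteq> 0" for x
    by (rule g0) (simp add: that)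
  have "inj_on g (topspace RP3)"
  proof (rule inj_onI)
    fix L L' assume "L \<in> topspace RP3" "L' \<in> topspace RP3" and eq: "g L = g L'"
    then obtain x y where L: "L = span {x}" "x \<noteq> 0" "L' = span {y}" "y \<noteq> 0"
      unfolding RP3_def topspace_quotient_topology by auto
    have proj_eq: "line_projector x = line_projector y"
      using eq[unfolded L(1,3) g[OF L(2)] g[OF L(4)]] .
    have "line_projector y *v y = y"
      using L(4) by (simp add: line_projector_mult)
    then obtain c where "c *\<^sub>R x = y"
      unfolding proj_eq[symmetric] line_projector_mult by blast
    then have "\<exists>c. c \<noteq> 0 \<and> y = c *\<^sub>R x"
      using L(4) by (intro exI[of _ c]) auto
    then show "L = L'"
      unfolding L(1,3) span_singleton_eq_iff[OF L(2,4)] .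
  qed
  then show ?thesis
    by (rule Hausdorff_space_injective_preimage[OF Hausdorff_space_euclidean cont_g])
qed

section \<open>Unit quaternions as a double cover of the rotation group\<close>

text \<open>The pair \<open>(z, w)\<close> stands for the quaternion \<open>z + w j\<close>, so that \<open>j z = cnj z j\<close> and \<open>j\<^sup>2 = - 1\<close> give
the product below. In these coordinates multiplication by a root of unity \<open>(c, 0)\<close> from the left or
the right acts diagonally, which is what makes the power map compatible with the cyclic part of the
dihedral group.\<close>

definition quat_mult :: "complex \<times> complex \<Rightarrow> complex \<times> complex \<Rightarrow> complex \<times> complex" (infixl "\<star>" 70) where
  "x \<star> y = (fst x * fst y - snd x * cnj (snd y), fst x * snd y + snd x * cnj (fst y))"

definition quat_cnj :: "complex \<times> complex \<Rightarrow> complex \<times> complex" where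
  "quat_cnj x = (cnj (fst x), - snd x)"

lemma quat_mult_Pair [simp]: "(z, w) \<star> (z', w') = (z * z' - w * cnj w', z * w' + w * cnj z')"
  by (simp add: quat_mult_def)

lemma quat_cnj_Pair [simp]: "quat_cnj (z, w) = (cnj z, - w)"
  by (simp add: quat_cnj_def)

lemma quat_mult_assoc: "(x \<star> y) \<star> t = x \<star> (y \<star> t)"
  by (simp add: quat_mult_def algebra_simps)

lemma quat_mult_one [simp]: "x \<star> (1, 0) = x" "(1, 0) \<star> x = x"
  by (simp_all add: quat_mult_def)

lemma quat_mult_minus [simp]: "x \<star> (- y) = - (x \<star> y)" "(- x) \<star> y = - (x \<star> y)"
  by (simp_all add: quat_mult_def)

lemma norm_quat_eq_1_iff: "norm (z, w) = 1 \<longleftrightarrow> (norm z)\<^sup>2 + (norm w)\<^sup>2 = (1::real)"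
  by (simp add: norm_Pair)

lemma norm_quat_mult: "norm (x \<star> y) = norm x * norm y"
proof (cases x, cases y)
  fix z w z' w' assume xy: "x = (z, w)" "y = (z', w')"
  have "(norm (x \<star> y))\<^sup>2 = (norm x)\<^sup>2 * (norm y)\<^sup>2"
    unfolding xy by (simp add: norm_Pair cmod_power2) (simp add: power2_eq_square algebra_simps)
  then show ?thesis
    by (metis norm_ge_zero power_mult_distrib power2_eq_imp_eq mult_nonneg_nonneg)
qed

lemma norm_quat_cnj [simp]: "norm (quat_cnj x) = norm x"
  by (cases x) (simp add: norm_Pair)

lemma quat_mult_cnj: 
  assumes "norm x = 1" shows "x \<star> quat_cnj x = (1, 0)" "quat_cnj x \<star> x = (1, 0)"
proof -
  obtain z w where x: "x = (z, w)" by (cases x)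
  have *: "z * cnj z + w * cnj w = 1"
    using assms unfolding x norm_quat_eq_1_iff
    by (metis complex_norm_square of_real_1 of_real_add)
  then show "x \<star> quat_cnj x = (1, 0)" "quat_cnj x \<star> x = (1, 0)"
    by (simp_all add: x algebra_simps)
qed

text \<open>For a unit quaternion \<open>x\<close>, the rotation \<open>p \<mapsto> x p x^(-1)\<close> of the imaginary quaternions, where
the first two coordinates of a vector form the complex number \<open>\<xi>\<close>, the third is \<open>t\<close>, and \<open>p = t i + \<xi> j\<close>. Thus
\<open>\<xi> \<mapsto> z\<^sup>2 \<xi> + w\<^sup>2 cnj \<xi> - 2 i t z w\<close> and \<open>t \<mapsto> (|z|\<^sup>2 - |w|\<^sup>2) t + 2 Im (z (cnj w) \<xi>)\<close>. With this
choice \<open>(c, 0)\<close> with \<open>|c| = 1\<close> is a rotation about the third axis, and \<open>(0, 1)\<close> is the half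
turn about the first axis.\<close>

definition quat_rot :: "complex \<times> complex \<Rightarrow> real^3^3" where
  "quat_rot x = (let z = fst x; w = snd x in vector
     [vector [Re (z\<^sup>2) + Re (w\<^sup>2), Im (w\<^sup>2) - Im (z\<^sup>2), 2 * Im (z * w)],
      vector [Im (z\<^sup>2) + Im (w\<^sup>2), Re (z\<^sup>2) - Re (w\<^sup>2), - 2 * Re (z * w)],
      vector [2 * Im (z * cnj w), 2 * Re (z * cnj w), (norm z)\<^sup>2 - (norm w)\<^sup>2]])"

lemma quat_rot_nth:
  "quat_rot (z, w) $ 1 $ 1 = Re (z\<^sup>2) + Re (w\<^sup>2)"
  "quat_rot (z, w) $ 1 $ 2 = Im (w\<^sup>2) - Im (z\<^sup>2)"
  "quat_rot (z, w) $ 1 $ 3 = 2 * Im (z * w)"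
  "quat_rot (z, w) $ 2 $ 1 = Im (z\<^sup>2) + Im (w\<^sup>2)"
  "quat_rot (z, w) $ 2 $ 2 = Re (z\<^sup>2) - Re (w\<^sup>2)"
  "quat_rot (z, w) $ 2 $ 3 = - 2 * Re (z * w)"
  "quat_rot (z, w) $ 3 $ 1 = 2 * Im (z * cnj w)"
  "quat_rot (z, w) $ 3 $ 2 = 2 * Re (z * cnj w)"
  "quat_rot (z, w) $ 3 $ 3 = (norm z)\<^sup>2 - (norm w)\<^sup>2"
  by (simp_all add: quat_rot_def vector_3)

lemma quat_rot_mult: "quat_rot (x \<star> y) = quat_rot x ** quat_rot y"
proof (cases x, cases y)
  fix z w z' w' assume xy: "x = (z, w)" "y = (z', w')"
  show ?thesis
    unfolding xy vec_eq_iff forall_3 matrix_matrix_mult_def quat_mult_Pair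
    by (simp add: quat_rot_nth sum_3 cmod_power2) (simp add: power2_eq_square algebra_simps)
qed

lemma quat_rot_one: "quat_rot (1, 0) = mat 1"
  by (simp add: vec_eq_iff forall_3 quat_rot_nth mat_def)

lemma quat_rot_minus [simp]: "quat_rot (- x) = quat_rot x"
  by (cases x) (simp add: vec_eq_iff forall_3 quat_rot_nth)

lemma quat_rot_cnj: "quat_rot (quat_cnj x) = transpose (quat_rot x)"
  by (cases x) (simp add: vec_eq_iff forall_3 quat_rot_nth transpose_def power2_eq_square algebra_simps)

lemma det_quat_rot: "det (quat_rot x) = (norm x) ^ 6"
proof (cases x)
  fix z w assume x: "x = (z, w)"
  have "(norm x) ^ 6 = ((norm x)\<^sup>2) ^ 3" by simp
  also have "\<dots> = ((Re z)\<^sup>2 + (Im z)\<^sup>2 + ((Re w)\<^sup>2 + (Im w)\<^sup>2)) ^ 3"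
    by (simp add: x norm_Pair cmod_power2)
  also have "\<dots> = det (quat_rot x)"
    unfolding x by (simp add: det_3 quat_rot_nth cmod_power2) (simp add: power2_eq_square power3_eq_cube algebra_simps)
  finally show ?thesis ..
qed

lemma rotation_matrix_quat_rot:
  assumes "norm x = 1" shows "rotation_matrix (quat_rot x)"
  using assms
  by (simp add: rotation_matrix_def orthogonal_matrix_def det_quat_rot quat_mult_cnj quat_rot_one
      flip: quat_rot_cnj quat_rot_mult)

text \<open>The entries of the matrix determine \<open>z\<^sup>2\<close>, \<open>w\<^sup>2\<close> and \<open>z w\<close>. The squares fix \<open>z\<close> and \<open>w\<close> up to sign,
and the product forces the two signs to agree.\<close>

lemma quat_rot_eq_iff: "quat_rot x = quat_rot y \<longleftrightarrow> y = x \<or> y = - x" if "norm x = 1" "norm y = 1"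
proof
  assume eq: "quat_rot x = quat_rot y"
  obtain z w z' w' where xy: "x = (z, w)" "y = (z', w')" by (cases x, cases y)
  have e: "quat_rot x $ i $ j = quat_rot y $ i $ j" for i j
    using eq by simp
  have "z\<^sup>2 = z'\<^sup>2" "w\<^sup>2 = w'\<^sup>2" "z * w = z' * w'"
    using e[of 1 1] e[of 1 2] e[of 2 1] e[of 2 2] e[of 1 3] e[of 2 3]
    unfolding xy quat_rot_nth complex_eq_iff by linarith+
  then show "y = x \<or> y = - x"
    unfolding xy power2_eq_iff by auto
qed auto

text \<open>The entries of \<open>A\<close> give candidates \<open>\<alpha>, \<beta>, \<gamma>, \<delta>\<close> for \<open>z\<^sup>2, w\<^sup>2, z w, z (cnj w)\<close>. Orthonormality of rows
and columns together with the equality of \<open>A\<close> with its cofactor matrix yields the relations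
\<open>\<gamma>\<^sup>2 = \<alpha> \<beta>\<close>, \<open>\<alpha> (cnj \<gamma>) = |\<alpha>| \<delta>\<close> and \<open>|\<alpha>| + |\<beta>| = 1\<close> that such products must satisfy, and these
suffice to solve for \<open>z\<close> and \<open>w\<close>.\<close>

lemma rotation_matrix_obtains_quat:
  assumes A: "rotation_matrix A"
  obtains x where "norm x = 1" "A = quat_rot x"
proof -
  have AT: "rotation_matrix (transpose A)"
    using A by (simp add: rotation_matrix_def orthogonal_matrix_def)
  define a where "a i j = A $ i $ j" for i j
  have ortho: "A ** transpose A = mat 1" "transpose A ** A = mat 1"
    using A by (auto simp: rotation_matrix_def orthogonal_matrix_def)
  have row: "a i 1 * a j 1 + a i 2 * a j 2 + a i 3 * a j 3 = (if i = j then 1 else 0)" for i j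
    using ortho(1) by (simp add: vec_eq_iff matrix_matrix_mult_def transpose_def mat_def sum_3 a_def)
  have col: "a 1 i * a 1 j + a 2 i * a 2 j + a 3 i * a 3 j = (if i = j then 1 else 0)" for i j
    using ortho(2) by (simp add: vec_eq_iff matrix_matrix_mult_def transpose_def mat_def sum_3 a_def)
  have block: "(a 1 1)\<^sup>2 + (a 1 2)\<^sup>2 + (a 2 1)\<^sup>2 + (a 2 2)\<^sup>2 = 1 + (a 3 3)\<^sup>2"
    using row[of 1 1] row[of 2 2] col[of 3 3] by (simp add: power2_eq_square)
  \<comment> \<open>The third row of a rotation matrix is the cross product of the first two.\<close>
  have minors: "a 3 3 = a 1 1 * a 2 2 - a 1 2 * a 2 1" 
     "a 3 2 = a 2 1 * a 1 3 - a 1 1 * a 2 3" "a 3 1 = a 1 2 * a 2 3 - a 1 3 * a 2 2"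
    using cross_rotation_matrix[OF AT, of "axis 1 1" "axis 2 1"]
    by (simp_all add: cross3_def vec_eq_iff forall_3 matrix_vector_mult_def sum_3 axis_def transpose_def vector_3 a_def
          algebra_simps)
  define \<alpha> where "\<alpha> = Complex ((a 1 1 + a 2 2) / 2) ((a 2 1 - a 1 2) / 2)"
  define \<beta> where "\<beta> = Complex ((a 1 1 - a 2 2) / 2) ((a 2 1 + a 1 2) / 2)"
  define \<gamma> where "\<gamma> = Complex (- a 2 3 / 2) (a 1 3 / 2)"
  define \<delta> where "\<delta> = Complex (a 3 2 / 2) (a 3 1 / 2)"
  have a33: "\<bar>a 3 3\<bar> \<le> 1"
  proof -
    have "(a 3 1)\<^sup>2 + (a 3 2)\<^sup>2 + (a 3 3)\<^sup>2 = 1"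
      using row[of 3 3] by (simp add: power2_eq_square)
    then have "(a 3 3)\<^sup>2 \<le> 1"
      using zero_le_power2[of "a 3 1"] zero_le_power2[of "a 3 2"] by linarith
    then show ?thesis by (simp add: abs_square_le_1)
  qed
  have "(norm \<alpha>)\<^sup>2 = ((1 + a 3 3) / 2)\<^sup>2"
  proof -
    have "(norm \<alpha>)\<^sup>2 = ((a 1 1)\<^sup>2 + (a 1 2)\<^sup>2 + (a 2 1)\<^sup>2 + (a 2 2)\<^sup>2
        + 2 * (a 1 1 * a 2 2 - a 1 2 * a 2 1)) / 4"
      unfolding cmod_power2 \<alpha>_def complex.sel by (simp add: power2_eq_square field_simps)
    then show ?thesis
      unfolding block minors(1)[symmetric] by (simp add: power2_eq_square field_simps)
  qed
  then have n\<alpha>: "norm \<alpha> = (1 + a 3 3) / 2"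
    using a33 by (simp add: power2_eq_iff_nonneg)
  have "(norm \<beta>)\<^sup>2 = ((1 - a 3 3) / 2)\<^sup>2"
  proof -
    have "(norm \<beta>)\<^sup>2 = ((a 1 1)\<^sup>2 + (a 1 2)\<^sup>2 + (a 2 1)\<^sup>2 + (a 2 2)\<^sup>2
        - 2 * (a 1 1 * a 2 2 - a 1 2 * a 2 1)) / 4"
      unfolding cmod_power2 \<beta>_def complex.sel by (simp add: power2_eq_square field_simps)
    then show ?thesis
      unfolding block minors(1)[symmetric] by (simp add: power2_eq_square field_simps)
  qed
  then have n\<beta>: "norm \<beta> = (1 - a 3 3) / 2"
    using a33 by (simp add: power2_eq_iff_nonneg)
  have \<gamma>2: "\<gamma>\<^sup>2 = \<alpha> * \<beta>"
  proof -
    have "(a 1 1)\<^sup>2 - (a 2 1)\<^sup>2 - (a 2 2)\<^sup>2 + (a 1 2)\<^sup>2 = (a 2 3)\<^sup>2 - (a 1 3)\<^sup>2"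
      using row[of 1 1] row[of 2 2] by (simp add: power2_eq_square)
    moreover have "a 1 1 * a 2 1 + a 1 2 * a 2 2 + a 1 3 * a 2 3 = 0"
      using row[of 1 2] by simp
    ultimately show ?thesis
      by (simp add: \<gamma>_def \<alpha>_def \<beta>_def complex_eq_iff power2_eq_square field_simps)
  qed
  have \<alpha>\<delta>: "\<alpha> * cnj \<gamma> = of_real (norm \<alpha>) * \<delta>"
  proof -
    have "a 1 1 * a 1 3 + a 2 1 * a 2 3 = - a 3 1 * a 3 3" "a 1 2 * a 1 3 + a 2 2 * a 2 3 = - a 3 2 * a 3 3"
      using col[of 1 3] col[of 2 3] by simp_all
    with minors(2,3) show ?thesis
      unfolding n\<alpha> unfolding \<gamma>_def \<alpha>_def \<delta>_def complex_eq_iff by (simp add: field_simps)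
  qed
  have ex: "\<exists>z w. z\<^sup>2 = \<alpha> \<and> w\<^sup>2 = \<beta> \<and> z * w = \<gamma> \<and> z * cnj w = \<delta>"
  proof (cases "\<alpha> = 0")
    case True
    then have "a 3 3 = - 1" using n\<alpha> by simp
    then have "a 1 3 * a 1 3 + a 2 3 * a 2 3 = 0" "a 3 1 * a 3 1 + a 3 2 * a 3 2 = 0"
      using col[of 3 3] row[of 3 3] by simp_all
    then have "\<gamma> = 0" "\<delta> = 0"
      by (auto simp: \<gamma>_def \<delta>_def complex_eq_iff sum_squares_eq_zero_iff)
    then show ?thesis
      using True by (intro exI[of _ 0] exI[of _ "csqrt \<beta>"]) simp
  next
    case False
    define z where "z = csqrt \<alpha>"
    have z: "z\<^sup>2 = \<alpha>" "z \<noteq> 0" using False by (auto simp: z_def)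
    have "(\<gamma> / z)\<^sup>2 = \<beta>"
      using False by (simp add: power_divide z \<gamma>2)
    moreover have "z * cnj (\<gamma> / z) = \<delta>"
    proof -
      have "z * cnj (\<gamma> / z) * (z * cnj z) = z\<^sup>2 * cnj \<gamma>"
        using z(2) by (simp add: field_simps power2_eq_square)
      also have "\<dots> = \<delta> * (z * cnj z)"
        using \<alpha>\<delta> by (simp add: z norm_power complex_norm_square[symmetric] flip: z(1))
      finally show ?thesis using z(2) by (simp add: field_simps)
    qed
    ultimately show ?thesis
      using z by (intro exI[of _ z] exI[of _ "\<gamma> / z"]) simp
  qed
  then obtain z w where zw: "z\<^sup>2 = \<alpha>" "w\<^sup>2 = \<beta>" "z * w = \<gamma>" "z * cnj w = \<delta>" by blast
  have n: "(norm z)\<^sup>2 = (1 + a 3 3) / 2" "(norm w)\<^sup>2 = (1 - a 3 3) / 2"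
    using n\<alpha> n\<beta> by (simp_all flip: zw norm_power)
  show thesis
  proof
    show "norm (z, w) = 1" unfolding norm_quat_eq_1_iff n by (simp add: field_simps)
    show "A = quat_rot (z, w)"
      unfolding vec_eq_iff forall_3 quat_rot_nth zw n
      by (simp add: \<alpha>_def \<beta>_def \<gamma>_def \<delta>_def a_def field_simps)
  qed
qed

lemma continuous_on_quat_rot: "continuous_on S quat_rot"
proof -
  have "continuous_on S (\<lambda>x. quat_rot x $ i $ j)" for i j
  proof -
    have "\<forall>i j. continuous_on S (\<lambda>x. quat_rot (fst x, snd x) $ i $ j)"
      unfolding forall_3 quat_rot_nth by (intro conjI continuous_intros)
    then show ?thesis by simp
  qed
  then have "continuous_on S (\<lambda>x. \<chi> i j. quat_rot x $ i $ j)"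
    by (intro continuous_on_vec_lambda)
  then show ?thesis by simp
qed

section \<open>A complete invariant of double cosets of the binary dihedral group\<close>

text \<open>The preimage in the unit quaternions of the dihedral group whose main axis is the third coordinate
axis and which contains the half turn about the first one. The exponent is \<open>2 n\<close> because the
\<open>n\<close>-th power of the rotation \<open>(c, 0)\<close> is trivial exactly if \<open>c ^ n\<close> is \<open>1\<close> or \<open>-1\<close>.\<close>

definition binary_dihedral :: "nat \<Rightarrow> (complex \<times> complex) set" where
  "binary_dihedral n = {(c, 0) | c. c ^ (2 * n) = 1} \<union> {(0, c) | c. c ^ (2 * n) = 1}"

lemma binary_dihedral_iff [simp]:
  "(c, d) \<in> binary_dihedral n \<longleftrightarrow> c ^ (2 * n) = 1 \<and> d = 0 \<or> c = 0 \<and> d ^ (2 * n) = 1"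
  by (auto simp: binary_dihedral_def)

lemma binary_dihedral_mult:
  assumes "g \<in> binary_dihedral n" "h \<in> binary_dihedral n"
  shows "g \<star> h \<in> binary_dihedral n"
  using assms
  by (cases g; cases h) (auto simp: power_mult_distrib power_minus_even simp flip: complex_cnj_power)

lemma binary_dihedral_cnj: "g \<in> binary_dihedral n \<Longrightarrow> quat_cnj g \<in> binary_dihedral n"
  by (cases g) (auto simp: power_minus_even simp flip: complex_cnj_power)

lemma binary_dihedral_minus: "g \<in> binary_dihedral n \<Longrightarrow> - g \<in> binary_dihedral n"
  by (cases g) (auto simp: power_minus_even)

lemma norm_binary_dihedral:
  assumes "0 < n" "g \<in> binary_dihedral n"
  shows "norm g = 1"
proof -
  have "norm c = 1" if "c ^ (2 * n) = 1" for c :: complex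
  proof -
    have "norm c ^ (2 * n) = 1" using that by (simp flip: norm_power)
    then show ?thesis using assms(1) power_eq_1_iff by force
  qed
  then show ?thesis
    using assms(2) by (cases g) (auto simp: norm_Pair)
qed

text \<open>The \<open>n\<close>-th powers \<open>Z = z^n\<close>, \<open>W = w^n\<close> divide out the cyclic rotations up to a common sign of \<open>Z\<close>
and \<open>W\<close>. What remains for odd \<open>n\<close> is multiplication by \<open>j\<close> from the two sides. In terms of
\<open>P = Re Z + i Re W\<close> and \<open>R = Im Z + i Im W\<close> this multiplies \<open>(P, R)\<close> by \<open>(i, -i)\<close> from the left and by
\<open>(i, i)\<close> from the right. Hence \<open>(P\<^sup>2, R\<^sup>2)\<close> is invariant up to a common sign.\<close>

definition double_coset_inv :: "nat \<Rightarrow> complex \<times> complex \<Rightarrow> complex \<times> complex" where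
  "double_coset_inv n x =
     ((Complex (Re (fst x ^ n)) (Re (snd x ^ n)))\<^sup>2, (Complex (Im (fst x ^ n)) (Im (snd x ^ n)))\<^sup>2)"

lemma complex_square_Complex: "(Complex a b)\<^sup>2 = Complex (a\<^sup>2 - b\<^sup>2) (2 * a * b)"
  by (simp add: complex_eq_iff power2_eq_square)

lemma double_coset_inv_root:
  assumes "c ^ (2 * n) = 1"
  shows "double_coset_inv n ((c, 0) \<star> x) = double_coset_inv n x"
    and "double_coset_inv n (x \<star> (c, 0)) = double_coset_inv n x"
proof -
  have "(c ^ n)\<^sup>2 = 1" using assms by (simp add: mult.commute flip: power_mult)
  then have "c ^ n = 1 \<or> c ^ n = - 1" by (simp add: power2_eq_1_iff)
  moreover from this have "cnj c ^ n = c ^ n" by (auto simp flip: complex_cnj_power)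
  ultimately show "double_coset_inv n ((c, 0) \<star> x) = double_coset_inv n x"
    and "double_coset_inv n (x \<star> (c, 0)) = double_coset_inv n x"
    by (cases x, auto simp: double_coset_inv_def power_mult_distrib complex_square_Complex)+
qed

lemma double_coset_inv_j:
  assumes "odd n"
  shows "double_coset_inv n ((0, 1) \<star> x) = - double_coset_inv n x"
    and "double_coset_inv n (x \<star> (0, 1)) = - double_coset_inv n x"
  using assms
  by (cases x, simp add: double_coset_inv_def complex_square_Complex complex_eq_iff flip: complex_cnj_power)+

lemma double_coset_inv_binary_dihedral:
  assumes n: "odd n" and g: "g \<in> binary_dihedral n"
  shows "double_coset_inv n (g \<star> x) \<in> {double_coset_inv n x, - double_coset_inv n x}"
    and "double_coset_inv n (x \<star> g) \<in> {double_coset_inv n x, - double_coset_inv n x}"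
proof -
  obtain c where c: "c ^ (2 * n) = 1" and "g = (c, 0) \<or> g = (0, c)"
    using g by (auto simp: binary_dihedral_def)
  then have g: "g = (c, 0) \<or> g = (c, 0) \<star> (0, 1)"
    by simp
  show "double_coset_inv n (g \<star> x) \<in> {double_coset_inv n x, - double_coset_inv n x}"
    using g n c by (elim disjE; simp only: quat_mult_assoc double_coset_inv_root double_coset_inv_j) simp_all
  show "double_coset_inv n (x \<star> g) \<in> {double_coset_inv n x, - double_coset_inv n x}"
    using g n c by (elim disjE; simp only: quat_mult_assoc[symmetric] double_coset_inv_root double_coset_inv_j) simp_all
qed

text \<open>The norm condition forces the factor \<open>k\<close> to be \<open>1\<close>, so the coordinates differ by \<open>n\<close>-th roots of
unity \<open>c\<close> and \<open>d\<close>. Multiplication by \<open>(a, 0)\<close> on the left and by \<open>(b, 0)\<close> on the right scales them by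
\<open>a b\<close> and \<open>a (cnj b)\<close>. Solving \<open>a b = c\<close>, \<open>a (cnj b) = d\<close> amounts to taking square roots of \<open>c d\<close> and
\<open>c (cnj d)\<close> among the \<open>n\<close>-th roots of unity, which is possible because \<open>n\<close> is odd.\<close>

lemma same_powers_imp_double_coset:
  assumes n: "odd n" and norm: "norm (z, w) = 1" "norm (z', w') = 1" and k: "0 \<le> k"
    and zn: "z' ^ n = complex_of_real k * z ^ n" and wn: "w' ^ n = complex_of_real k * w ^ n"
  shows "\<exists>g\<in>binary_dihedral n. \<exists>h\<in>binary_dihedral n. (z', w') = g \<star> (z, w) \<star> h"
proof -
  have n0: "0 < n" using n by (rule odd_pos)
  define t where "t = root n k"
  have t: "0 \<le> t" "t ^ n = k"
    using k n0 by (simp_all add: t_def)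
  have eq: "norm b = t * norm a" if "b ^ n = complex_of_real k * a ^ n" for a b
  proof -
    have "norm b ^ n = norm (of_real k * a ^ n)"
      using that by (metis norm_power)
    also have "\<dots> = (t * norm a) ^ n"
      using k t by (simp add: norm_mult norm_power power_mult_distrib)
    finally show ?thesis
      using t n0 by (simp add: power_eq_iff_eq_base)
  qed
  have "1 = (norm z')\<^sup>2 + (norm w')\<^sup>2"
    using norm(2) unfolding norm_quat_eq_1_iff by simp
  also have "\<dots> = t\<^sup>2 * ((norm z)\<^sup>2 + (norm w)\<^sup>2)"
    by (simp add: eq[OF zn] eq[OF wn] power_mult_distrib algebra_simps)
  also have "\<dots> = t\<^sup>2"
    using norm(1) unfolding norm_quat_eq_1_iff by simp
  finally have "t = 1"
    using t(1) by (simp add: power2_eq_1_iff)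
  then have k1: "k = 1" using t(2) by simp
  have ratio: "\<exists>c. c ^ n = 1 \<and> b = c * a" if "b ^ n = a ^ n" for a b :: complex
  proof (cases "a = 0")
    case True
    then show ?thesis using that n0 by (intro exI[of _ 1]) (simp add: zero_power)
  next
    case False
    then show ?thesis using that by (intro exI[of _ "b / a"]) (simp add: power_divide)
  qed
  have "z' ^ n = z ^ n" "w' ^ n = w ^ n"
    using zn wn by (simp_all add: k1)
  then obtain c d where c: "c ^ n = 1" "z' = c * z" and d: "d ^ n = 1" "w' = d * w"
    using ratio by metis
  obtain m where m: "n = 2 * m + 1" using n by (elim oddE)
  \<comment> \<open>For \<open>u ^ n = 1\<close> with \<open>n = 2 m + 1\<close>, the power \<open>u ^ (m + 1)\<close> is a square root of \<open>u\<close>.\<close>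
  define a where "a = (c * d) ^ (m + 1)"
  define b where "b = (c * cnj d) ^ (m + 1)"
  have norm1: "u * cnj u = 1" if "u ^ n = 1" for u
  proof -
    have "norm u ^ n = 1" using that by (simp flip: norm_power)
    then have "norm u = 1" using n0 power_eq_1_iff by force
    then show ?thesis by (simp flip: complex_norm_square)
  qed
  have dn: "cnj d ^ n = 1" using d(1) by (simp flip: complex_cnj_power)
  have sq: "(u ^ (m + 1))\<^sup>2 = u" if "u ^ n = 1" for u :: complex
  proof -
    have "(u ^ (m + 1))\<^sup>2 = u ^ (n + 1)"
      unfolding m power_mult[symmetric] by (simp add: algebra_simps)
    then show ?thesis using that by simp
  qed
  have "a * b = (c\<^sup>2 * (d * cnj d)) ^ (m + 1)"
    by (simp add: a_def b_def power2_eq_square ac_simps flip: power_mult_distrib)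
  then have ab: "a * b = c"
    using sq[OF c(1)] norm1[OF d(1)] by (metis mult.right_neutral power_mult mult.commute)
  have "a * cnj b = (d\<^sup>2 * (c * cnj c)) ^ (m + 1)"
    by (simp add: a_def b_def power2_eq_square ac_simps flip: power_mult_distrib)
  then have ab': "a * cnj b = d"
    using sq[OF d(1)] norm1[OF c(1)] by (metis mult.right_neutral power_mult mult.commute)
  have "a ^ n = 1" "b ^ n = 1"
    using c(1) d(1) dn by (simp_all add: a_def b_def power_mult_distrib mult.commute[of _ n] flip: power_mult)
       (simp_all add: power_mult)
  then have "a ^ (2 * n) = 1" "b ^ (2 * n) = 1"
    by (simp_all add: mult.commute[of 2] power_mult)
  moreover have "(z', w') = (a, 0) \<star> (z, w) \<star> (b, 0)"
    using ab ab' c d by (simp add: ac_simps)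
  ultimately show ?thesis
    by (intro bexI[of _ "(a, 0)"] bexI[of _ "(b, 0)"]) auto
qed

lemma double_coset_trans:
  assumes "g \<in> binary_dihedral n" "h \<in> binary_dihedral n"
    and "\<exists>g'\<in>binary_dihedral n. \<exists>h'\<in>binary_dihedral n. y = g' \<star> (g \<star> x \<star> h) \<star> h'"
  shows "\<exists>g\<in>binary_dihedral n. \<exists>h\<in>binary_dihedral n. y = g \<star> x \<star> h"
proof -
  obtain g' h' where "g' \<in> binary_dihedral n" "h' \<in> binary_dihedral n" "y = (g' \<star> g) \<star> x \<star> (h \<star> h')"
    using assms(3) by (auto simp: quat_mult_assoc)
  then show ?thesis
    using assms(1,2) binary_dihedral_mult by blast
qed

text \<open>If \<open>c\<close> is negative, replacing \<open>x\<close> by \<open>x j\<close> makes the factor positive. Then \<open>P\<close> and \<open>R\<close> agree for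
\<open>x\<close> and \<open>y\<close> up to the square root of this factor and independent signs \<open>s\<close> and \<open>s'\<close>. Both signs are absorbed by elements of the
binary dihedral group: equal signs by \<open>s\<close> itself, opposite ones by conjugation with \<open>j\<close>, which conjugates
\<open>Z\<close> and \<open>W\<close> and so changes the sign of \<open>R\<close> only.\<close>

lemma double_coset_inv_complete:
  assumes n: "odd n" and norm: "norm x = 1" "norm y = 1" and c: "c \<noteq> 0"
    and eq: "double_coset_inv n y = c *\<^sub>R double_coset_inv n x"
  shows "\<exists>g\<in>binary_dihedral n. \<exists>h\<in>binary_dihedral n. y = g \<star> x \<star> h"
proof -
  have pos: "\<exists>g\<in>binary_dihedral n. \<exists>h\<in>binary_dihedral n. y = g \<star> x \<star> h"
    if norm: "norm x = 1" and c: "0 < c" and eq: "double_coset_inv n y = c *\<^sub>R double_coset_inv n x" for x c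
  proof -
    obtain z w where x: "x = (z, w)" by (cases x)
    obtain z' w' where y: "y = (z', w')" by (cases y)
    define k where "k = sqrt c"
    have k: "0 \<le> k" "k\<^sup>2 = c" using c by (auto simp: k_def)
    have root: "p = of_real k * q \<or> p = - (of_real k * q)" if "p\<^sup>2 = c *\<^sub>R q\<^sup>2" for p q :: complex
    proof -
      have "p\<^sup>2 = (of_real k * q)\<^sup>2"
        using that by (simp add: power_mult_distrib scaleR_conv_of_real flip: k(2))
      then show ?thesis by (simp only: power2_eq_iff)
    qed
    let ?P = "\<lambda>z w. Complex (Re (z ^ n)) (Re (w ^ n))" and ?R = "\<lambda>z w. Complex (Im (z ^ n)) (Im (w ^ n))"
    have "?P z' w' = of_real k * ?P z w \<or> ?P z' w' = - (of_real k * ?P z w)"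
      and "?R z' w' = of_real k * ?R z w \<or> ?R z' w' = - (of_real k * ?R z w)"
      using eq by (intro root; simp add: x y double_coset_inv_def)+
    \<comment> \<open>Real factors for the signs leave two cases, equal and opposite, instead of four.\<close>
    then obtain s s' :: real where s: "s = 1 \<or> s = - 1" "s' = 1 \<or> s' = - 1"
      and P: "Re (z' ^ n) = s * k * Re (z ^ n)" "Re (w' ^ n) = s * k * Re (w ^ n)"
      and R: "Im (z' ^ n) = s' * k * Im (z ^ n)" "Im (w' ^ n) = s' * k * Im (w ^ n)"
      by (elim disjE) (force simp: complex_eq_iff)+
    have neg: "(- v) ^ n = - (v ^ n)" for v :: complex using n by simp
    have same: ?thesis if "s = s'"
    proof -
      have "norm (of_real s * z, of_real s * w) = 1"
        using norm s(1) by (auto simp: x norm_Pair)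
      then have "\<exists>g\<in>binary_dihedral n. \<exists>h\<in>binary_dihedral n. y = g \<star> (of_real s * z, of_real s * w) \<star> h"
        unfolding y using norm assms(3) k(1) s(1) P R \<open>s = s'\<close>
        by (intro same_powers_imp_double_coset[OF n _ _ k(1)]) (auto simp: x y neg complex_eq_iff)
      moreover have "(of_real s * z, of_real s * w) = (of_real s, 0) \<star> x \<star> (1, 0)"
        by (simp add: x)
      moreover have "(of_real s, 0) \<in> binary_dihedral n" "(1, 0) \<in> binary_dihedral n"
        using s(1) by auto
      ultimately show ?thesis using double_coset_trans by metis
    qed
    have opp: ?thesis if "s \<noteq> s'"
    proof -
      have s': "s' = - s" using s that by auto
      have "norm (of_real s * cnj z, of_real s * cnj w) = 1"
        using norm s(1) by (auto simp: x norm_Pair)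
      then have "\<exists>g\<in>binary_dihedral n. \<exists>h\<in>binary_dihedral n. y = g \<star> (of_real s * cnj z, of_real s * cnj w) \<star> h"
        unfolding y using norm assms(3) k(1) s(1) P R s'
        by (intro same_powers_imp_double_coset[OF n _ _ k(1)])
           (auto simp: x y neg complex_eq_iff simp flip: complex_cnj_power)
      \<comment> \<open>Conjugation by \<open>j\<close> conjugates both complex coordinates.\<close>
      moreover have "(of_real s * cnj z, of_real s * cnj w) = (0, of_real s) \<star> x \<star> (0, -1)"
        by (simp add: x)
      moreover have "(0, of_real s) \<in> binary_dihedral n" "(0, -1) \<in> binary_dihedral n"
        using s(1) by auto
      ultimately show ?thesis using double_coset_trans by metis
    qed
    show ?thesis using same opp by blast
  qed
  show ?thesis
  proof (cases "0 < c")
    case True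
    then show ?thesis using pos norm(1) eq by blast
  next
    case False
    have "double_coset_inv n y = (- c) *\<^sub>R double_coset_inv n (x \<star> (0, 1))"
      using eq unfolding double_coset_inv_j(2)[OF n] by simp
    moreover have "norm (x \<star> (0, 1)) = 1"
      using norm(1) by (simp add: norm_quat_mult norm_Pair)
    ultimately have "\<exists>g\<in>binary_dihedral n. \<exists>h\<in>binary_dihedral n. y = g \<star> (x \<star> (0, 1)) \<star> h"
      using pos[of "x \<star> (0, 1)" "- c"] False c by simp
    then show ?thesis
      using double_coset_trans[of "(1, 0)" n "(0, 1)" y x] by simp
  qed
qed

lemma double_coset_inv_eq_iff:
  assumes n: "odd n" and norm: "norm x = 1" "norm y = 1"
  shows "(\<exists>c. c \<noteq> 0 \<and> double_coset_inv n y = c *\<^sub>R double_coset_inv n x) \<longleftrightarrow>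
    (\<exists>g\<in>binary_dihedral n. \<exists>h\<in>binary_dihedral n. y = g \<star> x \<star> h)"
proof
  assume "\<exists>g\<in>binary_dihedral n. \<exists>h\<in>binary_dihedral n. y = g \<star> x \<star> h"
  then obtain g h where gh: "g \<in> binary_dihedral n" "h \<in> binary_dihedral n" and y: "y = g \<star> x \<star> h" by blast
  have "double_coset_inv n y \<in> {double_coset_inv n x, - double_coset_inv n x}"
    using double_coset_inv_binary_dihedral(1)[OF n gh(1), of x]
      double_coset_inv_binary_dihedral(2)[OF n gh(2), of "g \<star> x"] by (auto simp: y)
  then show "\<exists>c. c \<noteq> 0 \<and> double_coset_inv n y = c *\<^sub>R double_coset_inv n x"
    by (auto intro: exI[of _ 1] exI[of _ "- 1"])
qed (use double_coset_inv_complete[OF n norm] in blast)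

lemma double_coset_inv_scaleR:
  "double_coset_inv n (t *\<^sub>R x) = t ^ (2 * n) *\<^sub>R double_coset_inv n x"
  by (cases x) (simp add: double_coset_inv_def power_mult_distrib scaleR_conv_of_real
      complex_square_Complex complex_eq_iff power_mult power2_eq_square algebra_simps flip: of_real_power)

text \<open>Square roots of the two coordinates of \<open>p\<close> give \<open>P\<close> and \<open>R\<close>, hence \<open>Z\<close> and \<open>W\<close>, and \<open>n\<close>-th roots of
these give a nonzero quaternion, which is then normalised.\<close>

lemma double_coset_inv_onto_lines:
  assumes n: "0 < n" and p: "p \<noteq> 0"
  shows "\<exists>x c. norm x = 1 \<and> c \<noteq> 0 \<and> double_coset_inv n x = c *\<^sub>R p"
proof -
  have root: "\<exists>z. z ^ n = u" for u :: complex
  proof (cases "u = 0")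
    case False
    then have "card {z. z ^ n = u} \<noteq> 0" using n by (simp add: card_nth_roots)
    then show ?thesis by (metis (mono_tags) card.empty empty_Collect_eq)
  qed (use n in auto)
  define P where "P = csqrt (fst p)"
  define R where "R = csqrt (snd p)"
  obtain z w where zw: "z ^ n = Complex (Re P) (Re R)" "w ^ n = Complex (Im P) (Im R)"
    using root by metis
  have eq: "double_coset_inv n (z, w) = p"
    by (simp add: double_coset_inv_def zw) (simp add: P_def R_def del: csqrt.simps)
  have "(z, w) \<noteq> 0"
  proof
    assume "(z, w) = 0"
    then have "double_coset_inv n (z, w) = 0" 
      using n by (simp add: double_coset_inv_def zero_prod_def complex_square_Complex complex_eq_iff)
    then show False using eq p by simp
  qed
  then show ?thesis
    using eq n
    by (intro exI[of _ "(1 / norm (z, w)) *\<^sub>R (z, w)"] exI[of _ "(1 / norm (z, w)) ^ (2 * n)"])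
       (simp add: double_coset_inv_scaleR del: scaleR_Pair)
qed

lemma double_coset_inv_nonzero:
  assumes "norm x = 1" shows "double_coset_inv n x \<noteq> 0"
proof
  assume "double_coset_inv n x = 0"
  then have "Complex (Re (fst x ^ n)) (Re (snd x ^ n)) = 0" "Complex (Im (fst x ^ n)) (Im (snd x ^ n)) = 0"
    by (simp_all add: double_coset_inv_def zero_prod_def)
  then have "fst x ^ n = 0" "snd x ^ n = 0"
    by (simp_all add: complex_eq_iff)
  then have "x = 0" by (simp add: prod_eq_iff)
  then show False using assms by simp
qed

lemma continuous_on_double_coset_inv: "continuous_on S (double_coset_inv n)"
proof -
  have "double_coset_inv n = (\<lambda>x. ((of_real (Re (fst x ^ n)) + \<i> * of_real (Re (snd x ^ n)))\<^sup>2,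
     (of_real (Im (fst x ^ n)) + \<i> * of_real (Im (snd x ^ n)))\<^sup>2))"
    by (simp add: double_coset_inv_def Complex_eq fun_eq_iff)
  then show ?thesis
    by (auto intro!: continuous_intros)
qed

section \<open>Identification of pairs of complex numbers with four-space\<close>

definition vec4_of_pair :: "complex \<times> complex \<Rightarrow> real^4" where
  "vec4_of_pair p = vector [Re (fst p), Im (fst p), Re (snd p), Im (snd p)]"

lemma vec4_of_pair_nth:
  "vec4_of_pair p $ 1 = Re (fst p)" "vec4_of_pair p $ 2 = Im (fst p)"
  "vec4_of_pair p $ 3 = Re (snd p)" "vec4_of_pair p $ 4 = Im (snd p)"
  by (simp_all add: vec4_of_pair_def vector_def)

lemma linear_vec4_of_pair: "linear vec4_of_pair"
  by (rule linearI) (simp_all add: vec_eq_iff forall_4 vec4_of_pair_nth)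

lemma bij_vec4_of_pair: "bij vec4_of_pair"
proof (rule bijI)
  show "inj vec4_of_pair"
    by (rule injI) (auto simp: vec_eq_iff forall_4 vec4_of_pair_nth prod_eq_iff complex_eq_iff)
  have "v = vec4_of_pair (Complex (v $ 1) (v $ 2), Complex (v $ 3) (v $ 4))" for v
    by (simp add: vec_eq_iff forall_4 vec4_of_pair_nth)
  then show "surj vec4_of_pair" by (rule surjI[OF sym])
qed

section \<open>Dihedral groups in an adapted frame\<close>

text \<open>The double cover of the rotation group expressed in the orthonormal frame formed by the columns
of \<open>M\<close>.\<close>

definition framed_rot :: "real^3^3 \<Rightarrow> complex \<times> complex \<Rightarrow> real^3^3" where
  "framed_rot M x = M ** quat_rot x ** transpose M"

lemma rotation_matrix_closed:
  fixes A B :: "real^'n^'n"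
  shows "rotation_matrix A \<Longrightarrow> rotation_matrix B \<Longrightarrow> rotation_matrix (A ** B)"
  "rotation_matrix A \<Longrightarrow> rotation_matrix (transpose A)"
  "rotation_matrix A \<Longrightarrow> A ** transpose A = mat 1"
  "rotation_matrix A \<Longrightarrow> transpose A ** A = mat 1"
proof -
  show "rotation_matrix A \<Longrightarrow> rotation_matrix B \<Longrightarrow> rotation_matrix (A ** B)"
    by (simp add: rotation_matrix_def orthogonal_matrix_mul det_mul)
qed (simp_all add: rotation_matrix_def orthogonal_matrix_def)

context
  fixes M :: "real^3^3"
  assumes M: "rotation_matrix M"
begin

lemma framed_rot_one: "framed_rot M (1, 0) = mat 1"
  using M by (simp add: framed_rot_def quat_rot_one rotation_matrix_closed)

lemma framed_rot_mult: "framed_rot M (x \<star> y) = framed_rot M x ** framed_rot M y"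
proof -
  have "framed_rot M x ** framed_rot M y = M ** quat_rot x ** (transpose M ** M) ** quat_rot y ** transpose M"
    by (simp add: framed_rot_def matrix_mul_assoc)
  then show ?thesis
    using M by (simp add: framed_rot_def quat_rot_mult rotation_matrix_closed matrix_mul_assoc)
qed

lemma conjugate_framed_rot: "transpose M ** framed_rot M x ** M = quat_rot x"
proof -
  have "transpose M ** framed_rot M x ** M = (transpose M ** M) ** quat_rot x ** (transpose M ** M)"
    by (simp add: framed_rot_def matrix_mul_assoc)
  then show ?thesis using M by (simp add: rotation_matrix_closed)
qed

lemma rotation_matrix_framed_rot: "norm x = 1 \<Longrightarrow> rotation_matrix (framed_rot M x)"
  using M by (simp add: framed_rot_def rotation_matrix_closed rotation_matrix_quat_rot)

lemma framed_rot_eq_iff: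
  assumes "norm x = 1" "norm y = 1"
  shows "framed_rot M x = framed_rot M y \<longleftrightarrow> y = x \<or> y = - x"
proof -
  have "framed_rot M x = framed_rot M y \<longleftrightarrow> quat_rot x = quat_rot y"
    by (metis conjugate_framed_rot framed_rot_def)
  then show ?thesis using quat_rot_eq_iff[OF assms] by simp
qed

lemma framed_rot_surj:
  assumes "rotation_matrix A"
  obtains x where "norm x = 1" "A = framed_rot M x"
proof -
  have "rotation_matrix (transpose M ** A ** M)"
    using M assms by (simp add: rotation_matrix_closed)
  then obtain x where x: "norm x = 1" "transpose M ** A ** M = quat_rot x"
    by (rule rotation_matrix_obtains_quat)
  have "framed_rot M x = (M ** transpose M) ** A ** (M ** transpose M)"
    by (simp add: framed_rot_def flip: x(2)) (simp add: matrix_mul_assoc)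
  then have "A = framed_rot M x" using M by (simp add: rotation_matrix_closed)
  with x(1) show thesis by (rule that)
qed

lemma framed_rot_minus [simp]: "framed_rot M (- x) = framed_rot M x"
  by (simp add: framed_rot_def)

lemma inv_framed_rot:
  assumes "norm x = 1" shows "inv\<^bsub>SO3\<^esub> (framed_rot M x) = framed_rot M (quat_cnj x)"
proof (rule group.inv_equality[OF group_SO3])
  show "framed_rot M (quat_cnj x) \<otimes>\<^bsub>SO3\<^esub> framed_rot M x = \<one>\<^bsub>SO3\<^esub>"
    using assms by (simp add: quat_mult_cnj framed_rot_one flip: framed_rot_mult)
qed (use assms in \<open>simp_all add: rotation_matrix_framed_rot\<close>)

lemma framed_rot_fixes_iff:
  "framed_rot M x *v (M *v v) = M *v v \<longleftrightarrow> quat_rot x *v v = v"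
proof -
  have "framed_rot M x ** M = M ** quat_rot x"
    using M by (simp add: framed_rot_def rotation_matrix_closed flip: matrix_mul_assoc)
  then have "framed_rot M x *v (M *v v) = M *v (quat_rot x *v v)"
    by (simp add: matrix_vector_mul_assoc)
  moreover have "M *v a = M *v b \<longleftrightarrow> a = b" for a b
    using M by (metis matrix_vector_mul_assoc matrix_vector_mul_lid rotation_matrix_closed(4))
  ultimately show ?thesis by simp
qed

lemma continuous_on_framed_rot: "continuous_on S (framed_rot M)"
proof -
  have "continuous_on UNIV (\<lambda>A. M ** A ** transpose M)"
    unfolding matrix_matrix_mult_def by (intro continuous_on_vec_lambda continuous_intros)
  then have "continuous_on S (\<lambda>x. M ** quat_rot x ** transpose M)"
    using continuous_on_compose2[OF _ continuous_on_quat_rot] by blast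
  then show ?thesis by (simp add: framed_rot_def[abs_def])
qed

end

lemma mult_axis: "(A *v axis k 1) $ i = (A $ i $ k :: real)"
  by (simp add: matrix_vector_mult_def axis_def if_distrib cong: if_cong)

lemma quat_rot_fixes_third_axis:
  assumes "norm x = 1" and fixed: "quat_rot x *v axis 3 1 = axis 3 1"
  obtains c where "x = (c, 0)" "norm c = 1"
proof -
  obtain z w where x: "x = (z, w)" by (cases x)
  have "(norm z)\<^sup>2 - (norm w)\<^sup>2 = 1"
    using arg_cong[OF fixed, of "\<lambda>v. v $ 3"] by (simp add: mult_axis x quat_rot_nth)
  moreover have n: "(norm z)\<^sup>2 + (norm w)\<^sup>2 = 1"
    using assms(1) unfolding x norm_quat_eq_1_iff .
  ultimately have "(norm w)\<^sup>2 = 0" by linarith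
  then have "w = 0" by simp
  with n have "norm z = 1" by (simp add: power2_eq_1_iff) (use norm_ge_zero[of z] in linarith)
  with \<open>w = 0\<close> show thesis using x that by blast
qed

text \<open>A quaternion over a rotation of order two squares to \<open>-1\<close>, since only \<open>1\<close> and \<open>-1\<close> square to \<open>1\<close>.
It is therefore purely imaginary, and the fixed axis determines it up to sign.\<close>

lemma quat_rot_half_turn_first_axis:
  assumes "norm x = 1" and fixed: "quat_rot x *v axis 1 1 = axis 1 1"
    and sq: "quat_rot x ** quat_rot x = mat 1" and ne: "quat_rot x \<noteq> mat 1"
  shows "x = (0, 1) \<or> x = - (0, 1)"
proof -
  obtain z w where x: "x = (z, w)" by (cases x)
  have n: "(norm z)\<^sup>2 + (norm w)\<^sup>2 = 1"
    using assms(1) unfolding x norm_quat_eq_1_iff .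
  have "x \<star> x = (1, 0) \<or> x \<star> x = - (1, 0)"
    using sq quat_rot_eq_iff[of "(1, 0)" "x \<star> x"] assms(1)
    by (simp add: quat_rot_mult quat_rot_one norm_quat_mult norm_Pair del: quat_mult_Pair)
  moreover have "x \<star> x \<noteq> (1, 0)"
  proof
    assume "x \<star> x = (1, 0)"
    then have "x = quat_cnj x"
      using quat_mult_cnj(2)[OF assms(1)] by (metis quat_mult_assoc quat_mult_one)
    then have "w = 0" "Im z = 0"
      by (auto simp: x complex_eq_iff)
    moreover from this n have "(Re z)\<^sup>2 = 1"
      by (simp add: cmod_power2)
    ultimately have "x = (1, 0) \<or> x = - (1, 0)"
      by (auto simp: x complex_eq_iff power2_eq_1_iff)
    then show False using ne quat_rot_one by (metis quat_rot_minus)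
  qed
  ultimately have "x \<star> x = - (1, 0)" by blast
  moreover have "quat_cnj x \<star> (x \<star> x) = x"
    using quat_mult_cnj(2)[OF assms(1)] by (simp flip: quat_mult_assoc)
  ultimately have "quat_cnj x = - x"
    by (metis quat_mult_minus(1) quat_mult_one(1) minus_minus)
  then have "Re z = 0"
    by (simp add: x complex_eq_iff)
  have "Re (z\<^sup>2) + Re (w\<^sup>2) = 1"
    using arg_cong[OF fixed, of "\<lambda>v. v $ 1"] by (simp add: mult_axis x quat_rot_nth)
  then have "(Re w)\<^sup>2 - (Im w)\<^sup>2 - (Im z)\<^sup>2 = 1" and "(Im z)\<^sup>2 + (Re w)\<^sup>2 + (Im w)\<^sup>2 = 1"
    using n \<open>Re z = 0\<close> by (simp_all add: power2_eq_square cmod_power2[unfolded power2_eq_square])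
  then have "Im z = 0 \<and> Im w = 0 \<and> (Re w)\<^sup>2 = 1"
    by (smt (verit) zero_le_power2 power2_eq_iff_nonneg zero_eq_power2)
  then show ?thesis
    using \<open>Re z = 0\<close> by (auto simp: x complex_eq_iff power2_eq_1_iff)
qed

text \<open>Having moved the third coordinate axis to \<open>u\<close>, the preimage \<open>w\<close> of \<open>v\<close> is a unit vector in the plane
of the first two axes. A rotation about the third axis takes the first axis to it; its
quaternion is a square root of \<open>w\<close> because rotation angles are halved.\<close>

lemma rotation_matrix_exists_two_axes:
  fixes u v :: "real^3"
  assumes "orthogonal u v" "u \<noteq> 0" "v \<noteq> 0"
  obtains M where "rotation_matrix M" "M *v axis 3 1 = u /\<^sub>R norm u" "M *v axis 1 1 = v /\<^sub>R norm v"
proof -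
  obtain A where A: "rotation_matrix A" "A *v axis 3 1 = u /\<^sub>R norm u"
    by (rule rotation_matrix_exists_basis[of "u /\<^sub>R norm u" 3]) (use assms in auto)
  define w where "w = transpose A *v (v /\<^sub>R norm v)"
  have AT: "orthogonal_transformation (\<lambda>x. transpose A *v x)"
    using rotation_matrix_closed(2)[OF A(1)] unfolding rotation_matrix_def
    by (auto simp only: orthogonal_transformation_matrix matrix_vector_mul_linear matrix_of_matrix_vector_mul)
  have Aw: "A *v w = v /\<^sub>R norm v"
    unfolding w_def matrix_vector_mul_assoc rotation_matrix_closed(3)[OF A(1)]
    by (rule matrix_vector_mul_lid)
  have "transpose A *v (u /\<^sub>R norm u) = axis 3 1"
    unfolding A(2)[symmetric] matrix_vector_mul_assoc rotation_matrix_closed(4)[OF A(1)]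
    by (rule matrix_vector_mul_lid)
  moreover have "(transpose A *v a) \<bullet> (transpose A *v b) = a \<bullet> b" for a b
    using AT unfolding orthogonal_transformation_def by blast
  ultimately have "axis 3 1 \<bullet> w = (u /\<^sub>R norm u) \<bullet> (v /\<^sub>R norm v)"
    unfolding w_def by metis
  then have w3: "w $ 3 = 0"
    using assms(1) by (simp add: orthogonal_def inner_axis')
  have "norm w = norm (v /\<^sub>R norm v)"
    unfolding w_def by (rule orthogonal_transformation_norm[OF AT])
  then have "norm w = 1"
    using assms(3) by simp
  then have n: "(w $ 1)\<^sup>2 + (w $ 2)\<^sup>2 = 1"
    using w3 by (simp add: norm_eq_1 inner_vec_def sum_3 power2_eq_square)
  \<comment> \<open>\<open>quat_rot (c, 0)\<close> turns the plane by multiplication with \<open>c\<^sup>2\<close>.\<close>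
  define c where "c = csqrt (Complex (w $ 1) (w $ 2))"
  have c2: "c\<^sup>2 = Complex (w $ 1) (w $ 2)" by (simp add: c_def del: csqrt.simps)
  have "(norm c)\<^sup>2 = 1"
    unfolding norm_power[symmetric] c2 by (simp add: cmod_def n)
  then have nc: "norm (c, 0::complex) = 1"
    by (simp add: norm_Pair)
  have e3: "quat_rot (c, 0) *v axis 3 1 = axis 3 1"
    using \<open>(norm c)\<^sup>2 = 1\<close> by (simp add: vec_eq_iff forall_3 mult_axis quat_rot_nth) (simp add: axis_def)
  have e1: "quat_rot (c, 0) *v axis 1 1 = w"
    by (simp add: vec_eq_iff forall_3 mult_axis quat_rot_nth c2 w3)
  show thesis
  proof
    show "rotation_matrix (A ** quat_rot (c, 0))"
      using A(1) rotation_matrix_quat_rot[OF nc] by (rule rotation_matrix_closed)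
    show "(A ** quat_rot (c, 0)) *v axis 3 1 = u /\<^sub>R norm u"
      by (simp add: e3 A(2) flip: matrix_vector_mul_assoc)
    show "(A ** quat_rot (c, 0)) *v axis 1 1 = v /\<^sub>R norm v"
      by (simp add: e1 Aw flip: matrix_vector_mul_assoc)
  qed
qed

text \<open>In a frame adapted to the two axes the generators are the images of some \<open>(c, 0)\<close> and of \<open>(0, 1)\<close>,
both in the binary dihedral group. Conversely, the powers of the generator of order \<open>n\<close> are \<open>n\<close>
distinct elements among the images of the pairs \<open>(d, 0)\<close> with \<open>d ^ n = 1\<close>, so by counting they are all
of these. Since \<open>n\<close> is odd, every \<open>(2 n)\<close>-th root of unity is up to sign an \<open>n\<close>-th root of unity, and
the sign disappears in the rotation group.\<close>

lemma dihedral_rotation_group_eq_framed_rot: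
  assumes D: "dihedral_rotation_group n D" and odd: "odd n"
  obtains M where "rotation_matrix M" "D = framed_rot M ` binary_dihedral n"
proof -
  interpret S: group SO3 by (rule group_SO3)
  obtain u v r s where n0: "0 < n" and uv: "orthogonal u v"
    and r: "rotation_about u r" "S.ord r = n" and s: "rotation_about v s" "S.ord s = 2"
    and Dgen: "D = generate SO3 {r, s}"
    using D by (auto simp: dihedral_rotation_group_def)
  have rs: "rotation_matrix r" "rotation_matrix s" "u \<noteq> 0" "v \<noteq> 0" "r *v u = u" "s *v v = v"
    using r(1) s(1) by (auto simp: rotation_about_def)
  have mem: "r \<in> carrier SO3" "s \<in> carrier SO3" using rs by simp_all
  obtain M where M: "rotation_matrix M" "M *v axis 3 1 = u /\<^sub>R norm u" "M *v axis 1 1 = v /\<^sub>R norm v"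
    using rotation_matrix_exists_two_axes[OF uv rs(3,4)] .
  let ?R = "framed_rot M"
  have norm_\<Gamma>: "norm g = 1" if "g \<in> binary_dihedral n" for g
    using norm_binary_dihedral[OF n0 that] .
  obtain x where x: "norm x = 1" "r = ?R x" using framed_rot_surj[OF M(1) rs(1)] .
  have "?R x *v (M *v axis 3 1) = M *v axis 3 1"
    unfolding M(2) x(2)[symmetric] using rs(5) by (simp add: matrix_vector_mult_scaleR)
  then obtain c where c: "x = (c, 0)" "norm c = 1"
    using quat_rot_fixes_third_axis[OF x(1)] framed_rot_fixes_iff[OF M(1)] by blast
  have pow: "r [^]\<^bsub>SO3\<^esub> k = ?R (c ^ k, 0)" for k :: nat
    by (induction k) (simp_all add: framed_rot_one[OF M(1)] x(2) c(1) mult.commute flip: framed_rot_mult[OF M(1)])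
  have "?R (c ^ n, 0) = ?R (1, 0)"
    using S.pow_ord_eq_1[OF mem(1)] by (simp add: r(2) pow framed_rot_one[OF M(1)])
  then have "c ^ n = 1 \<or> - (c ^ n) = 1"
    using framed_rot_eq_iff[OF M(1), of "(c ^ n, 0)" "(1, 0)"] c(2)
    by (auto simp: norm_Pair norm_power)
  then have "c ^ n = 1 \<or> c ^ n = - 1"
    by (metis minus_minus)
  then have c2n: "c ^ (2 * n) = 1"
    by (auto simp: mult.commute[of 2] power_mult)
  obtain y where y: "norm y = 1" "s = ?R y" using framed_rot_surj[OF M(1) rs(2)] .
  have "?R y *v (M *v axis 1 1) = M *v axis 1 1"
    unfolding M(3) y(2)[symmetric] using rs(6) by (simp add: matrix_vector_mult_scaleR)
  then have y1: "quat_rot y *v axis 1 1 = axis 1 1"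
    using framed_rot_fixes_iff[OF M(1)] by blast
  have ss: "s ** s = mat 1"
    using S.pow_ord_eq_1[OF mem(2)] by (simp add: s(2) numeral_2_eq_2)
  have "quat_rot y ** quat_rot y = mat 1"
    using ss unfolding y(2) framed_rot_mult[OF M(1), symmetric]
    by (metis conjugate_framed_rot[OF M(1)] quat_rot_mult framed_rot_one[OF M(1)] quat_rot_one)
  moreover have "quat_rot y \<noteq> mat 1"
  proof
    assume "quat_rot y = mat 1"
    then have "s = \<one>\<^bsub>SO3\<^esub>"
      using M(1) by (simp add: y(2) framed_rot_def rotation_matrix_closed)
    then show False using s(2) S.ord_id by simp
  qed
  ultimately have "y = (0, 1) \<or> y = - (0, 1)"
    using quat_rot_half_turn_first_axis[OF y(1) y1] by blast
  then have s_eq: "s = ?R (0, 1)"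
    using framed_rot_minus[OF M(1), of "(0, 1)"] y(2) by auto
  have "D \<subseteq> ?R ` binary_dihedral n"
    unfolding Dgen
  proof (rule S.generate_subgroup_incl)
    show "{r, s} \<subseteq> ?R ` binary_dihedral n"
      using c2n by (auto simp: x(2) c(1) s_eq intro!: imageI)
    show "subgroup (?R ` binary_dihedral n) SO3"
    proof (rule S.subgroupI)
      show "?R ` binary_dihedral n \<subseteq> carrier SO3"
        using norm_\<Gamma> rotation_matrix_framed_rot[OF M(1)] by auto
      show "?R ` binary_dihedral n \<noteq> {}"
        using c2n by (auto simp: binary_dihedral_def)
      show "inv\<^bsub>SO3\<^esub> a \<in> ?R ` binary_dihedral n" if "a \<in> ?R ` binary_dihedral n" for a
        using that inv_framed_rot[OF M(1)] norm_\<Gamma> binary_dihedral_cnj by auto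
      show "a \<otimes>\<^bsub>SO3\<^esub> b \<in> ?R ` binary_dihedral n"
        if "a \<in> ?R ` binary_dihedral n" "b \<in> ?R ` binary_dihedral n" for a b
        using that binary_dihedral_mult by (auto simp flip: framed_rot_mult[OF M(1)])
    qed
  qed
  moreover have "?R ` binary_dihedral n \<subseteq> D"
  proof -
    have subD: "subgroup D SO3" by (rule dihedral_rotation_group_subgroup[OF D])
    have rD: "r \<in> D" and sD: "s \<in> D"
      by (auto simp: Dgen intro: generate.incl)
    let ?C = "(\<lambda>d. ?R (d, 0)) ` {d. d ^ n = 1}"
    have two_n: "\<exists>e. e ^ n = 1 \<and> (d = e \<or> d = - e)" if "d ^ (2 * n) = 1" for d :: complex
    proof -
      have "d ^ n = 1 \<or> d ^ n = - 1"
        using that by (metis mult.commute power_mult power2_eq_1_iff)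
      then show ?thesis
        using odd by (metis minus_minus power_minus_odd)
    qed
    have minus: "?R (- d, 0) = ?R (d, 0)" for d
      using framed_rot_minus[OF M(1), of "(d, 0)"] by simp
    have "(\<lambda>k. r [^]\<^bsub>SO3\<^esub> k) ` {0..n - 1} = ?C"
    proof (rule card_seteq)
      have fin: "finite {d::complex. d ^ n = 1}"
        using n0 by (intro finite_roots_unity) simp
      then show "finite ?C" by simp
      show "(\<lambda>k. r [^]\<^bsub>SO3\<^esub> k) ` {0..n - 1} \<subseteq> ?C"
      proof clarify
        fix k :: nat
        have "(c ^ k) ^ (2 * n) = 1" using c2n by (metis mult.commute power_mult power_one)
        then obtain e where "e ^ n = 1" "c ^ k = e \<or> c ^ k = - e" using two_n by blast
        then show "r [^]\<^bsub>SO3\<^esub> k \<in> ?C" using minus by (auto simp: pow)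
      qed
      have "card ?C \<le> n"
        using card_image_le[OF fin] card_roots_unity_eq[OF n0] by metis
      also have "n = card ((\<lambda>k. r [^]\<^bsub>SO3\<^esub> k) ` {0..n - 1})"
        using card_image[OF S.ord_inj[OF mem(1)]] n0 by (simp add: r(2))
      finally show "card ?C \<le> card ((\<lambda>k. r [^]\<^bsub>SO3\<^esub> k) ` {0..n - 1})" .
    qed
    moreover have "r [^]\<^bsub>SO3\<^esub> k \<in> D" for k :: nat
    proof (induction k)
      case 0
      show ?case using subgroup.one_closed[OF subD] by (simp del: SO3_simps)
    next
      case (Suc k)
      then show ?case using subgroup.m_closed[OF subD _ rD] by (simp del: SO3_simps)
    qed
    ultimately have "?C \<subseteq> D" by (metis image_subsetI)
    then have CD: "?R (d, 0) \<in> D" if "d ^ n = 1" for d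
      using that by auto
    have CD2: "?R (d, 0) \<in> D" if "d ^ (2 * n) = 1" for d
      using two_n[OF that] CD minus by metis
    have "?R (0, d) \<in> D" if "d ^ (2 * n) = 1" for d
    proof -
      have "?R (0, d) = ?R (d, 0) \<otimes>\<^bsub>SO3\<^esub> s"
        by (simp add: s_eq flip: framed_rot_mult[OF M(1)])
      then show ?thesis
        using subgroup.m_closed[OF subD CD2[OF that] sD] by simp
    qed
    with CD2 show ?thesis by (auto simp: binary_dihedral_def)
  qed
  ultimately show thesis using M(1) that by blast
qed

section \<open>The misorientation space\<close>

lemma mem_orbit_misorientation_iff:
  assumes "A \<in> carrier SO3"
  shows "B \<in> orbit (SO3_subgroup_prod G1 G2) misorientation_action A \<longleftrightarrow>
    (\<exists>a\<in>G1. \<exists>b\<in>G2. B = a ** A ** inv\<^bsub>SO3\<^esub> b)"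
  using assms by (force simp: orbit_def misorientation_action_def DirProd_def)

text \<open>Equality of rotations lifts to equality of quaternions up to sign, and the sign is absorbed by
the binary dihedral group. So orbits of rotations correspond to double cosets of quaternions.\<close>

lemma orbit_framed_rot_eq_iff:
  assumes M: "rotation_matrix M" and D: "D = framed_rot M ` binary_dihedral n" and n: "0 < n"
    and sub: "subgroup D SO3" and norm: "norm x = 1" "norm y = 1"
  defines "orb \<equiv> orbit (SO3_subgroup_prod D D) misorientation_action"
  shows "orb (framed_rot M x) = orb (framed_rot M y) \<longleftrightarrow>
    (\<exists>g\<in>binary_dihedral n. \<exists>h\<in>binary_dihedral n. y = g \<star> x \<star> h)"
proof -
  let ?R = "framed_rot M"
  interpret group_action "SO3_subgroup_prod D D" "carrier SO3" misorientation_action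
    using sub sub by (rule group_action_misorientation)
  have norm_\<Gamma>: "norm g = 1" if "g \<in> binary_dihedral n" for g
    using norm_binary_dihedral[OF n that] .
  have cx: "?R x \<in> carrier SO3" and cy: "?R y \<in> carrier SO3"
    using norm rotation_matrix_framed_rot[OF M] by simp_all
  have "?R y \<in> orb (?R x) \<longleftrightarrow>
      (\<exists>g\<in>binary_dihedral n. \<exists>h\<in>binary_dihedral n. ?R y = ?R g ** ?R x ** ?R (quat_cnj h))"
    unfolding orb_def mem_orbit_misorientation_iff[OF cx] D
    using inv_framed_rot[OF M norm_\<Gamma>] by auto
  also have "\<dots> \<longleftrightarrow> (\<exists>g\<in>binary_dihedral n. \<exists>h\<in>binary_dihedral n. y = g \<star> x \<star> h)"
  proof safe
    fix g h assume gh: "g \<in> binary_dihedral n" "h \<in> binary_dihedral n"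
      and "?R y = ?R g ** ?R x ** ?R (quat_cnj h)"
    then have "?R (g \<star> x \<star> quat_cnj h) = ?R y"
      by (simp add: framed_rot_mult[OF M])
    then have "y = g \<star> x \<star> quat_cnj h \<or> y = - (g \<star> x \<star> quat_cnj h)"
      using framed_rot_eq_iff[OF M _ norm(2)] norm(1) norm_\<Gamma>[OF gh(1)] norm_\<Gamma>[OF gh(2)]
      by (simp add: norm_quat_mult)
    then have "y = g \<star> x \<star> quat_cnj h \<or> y = (- g) \<star> x \<star> quat_cnj h"
      by simp
    then show "\<exists>g\<in>binary_dihedral n. \<exists>h\<in>binary_dihedral n. y = g \<star> x \<star> h"
      using gh binary_dihedral_cnj binary_dihedral_minus by blast
  next
    fix g h assume "g \<in> binary_dihedral n" "h \<in> binary_dihedral n" "y = g \<star> x \<star> h"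
    then show "\<exists>g'\<in>binary_dihedral n. \<exists>h'\<in>binary_dihedral n.
        ?R (g \<star> x \<star> h) = ?R g' ** ?R x ** ?R (quat_cnj h')"
      using binary_dihedral_cnj[of h n]
      by (intro bexI[of _ g] bexI[of _ "quat_cnj h"]) (simp_all add: framed_rot_mult[OF M] quat_cnj_def)
  qed
  also have "?R y \<in> orb (?R x) \<longleftrightarrow> orb (?R x) = orb (?R y)"
  proof
    assume y: "?R y \<in> orb (?R x)"
    have sub: "orb B \<subseteq> orb A" if "A \<in> carrier SO3" "B \<in> carrier SO3" "B \<in> orb A" for A B
    proof
      fix C assume C: "C \<in> orb B"
      then have "C \<in> carrier SO3"
        using element_image[OF _ that(2)] by (auto simp: orb_def orbit_def simp del: SO3_simps)
      then show "C \<in> orb A"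
        using orbit_trans[OF that(1,2) _ that(3)[unfolded orb_def] C[unfolded orb_def]] by (simp add: orb_def)
    qed
    have "?R x \<in> orb (?R y)"
      using orbit_sym[OF cx cy] y by (simp add: orb_def)
    then show "orb (?R x) = orb (?R y)"
      using sub cx cy y by blast
  next
    assume "orb (?R x) = orb (?R y)"
    then show "?R y \<in> orb (?R x)"
      using orbit_refl[OF cy] by (simp add: orb_def)
  qed
  finally show ?thesis .
qed

theorem proposition3p5:
  fixes n :: nat and D :: "(real^3^3) set"
  assumes "dihedral_rotation_group n D"
    and "odd n"
  shows "misorientation_space D D homeomorphic_space RP3"
proof -
  let ?S = "sphere (0 :: complex \<times> complex) 1"
  let ?orb = "orbit (SO3_subgroup_prod D D) misorientation_action"
  have n0: "0 < n" using assms(2) by (rule odd_pos)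
  obtain M where M: "rotation_matrix M" and D: "D = framed_rot M ` binary_dihedral n"
    using dihedral_rotation_group_eq_framed_rot[OF assms] .
  have compact: "compact_space (top_of_set ?S)"
    by (simp add: compact_space_subtopology)
  have "quotient_map (top_of_set ?S) (top_of_set (carrier SO3)) (framed_rot M)"
  proof (rule continuous_imp_quotient_map[OF _ compact])
    show "continuous_map (top_of_set ?S) (top_of_set (carrier SO3)) (framed_rot M)"
      using continuous_on_framed_rot[OF M] rotation_matrix_framed_rot[OF M]
      by (auto simp: continuous_map_in_subtopology)
    show "Hausdorff_space (top_of_set (carrier SO3))"
      by (rule Hausdorff_space_subtopology[OF Hausdorff_space_euclidean])
    show "framed_rot M ` topspace (top_of_set ?S) = topspace (top_of_set (carrier SO3))"
      using rotation_matrix_framed_rot[OF M] by (auto elim!: framed_rot_surj[OF M])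
  qed
  then have quot_X: "quotient_map (top_of_set ?S) (misorientation_space D D) (?orb \<circ> framed_rot M)"
    unfolding misorientation_space_def by (rule quotient_map_compose) (rule quotient_map_quotient_topology)
  let ?v = "\<lambda>x. vec4_of_pair (double_coset_inv n x)"
  interpret linear vec4_of_pair by (rule linear_vec4_of_pair)
  have inj: "vec4_of_pair p = vec4_of_pair q \<longleftrightarrow> p = q" for p q
    using bij_vec4_of_pair by (metis bij_pointE)
  have v0: "?v x \<noteq> 0" if "norm x = 1" for x
    using double_coset_inv_nonzero[OF that] inj[of _ 0] by (simp add: zero)
  have quot_R: "quotient_map (top_of_set ?S) RP3 (\<lambda>x. span {?v x})"
  proof (rule continuous_imp_quotient_map[OF _ compact Hausdorff_space_RP3])
    have "continuous_on ?S ?v"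
      by (intro linear_continuous_on_compose[OF continuous_on_double_coset_inv linear_vec4_of_pair])
    then have 1: "continuous_map (top_of_set ?S) (top_of_set (- {0})) ?v"
      using v0 by (auto simp: continuous_map_in_subtopology)
    have 2: "continuous_map (top_of_set (- {0})) RP3 (\<lambda>x. span {x})"
      unfolding RP3_def by (intro quotient_imp_continuous_map quotient_map_quotient_topology)
    show "continuous_map (top_of_set ?S) RP3 (\<lambda>x. span {?v x})"
      using continuous_map_compose[OF 1 2] by (simp add: o_def)
    have "span {a} \<in> (\<lambda>x. span {?v x}) ` ?S" if a: "a \<noteq> 0" for a
    proof -
      obtain p where p: "a = vec4_of_pair p" using bij_vec4_of_pair by (metis bij_pointE)
      then have "p \<noteq> 0" using a zero by auto
      then obtain x c where x: "norm x = 1" "c \<noteq> 0" "double_coset_inv n x = c *\<^sub>R p"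
        using double_coset_inv_onto_lines[OF n0] by blast
      then have "?v x = c *\<^sub>R a" by (simp add: p scale)
      then have "span {a} = span {?v x}"
        unfolding span_singleton_eq_iff[OF a v0[OF x(1)]] using x(2) by blast
      then show ?thesis using x(1) by auto
    qed
    then show "(\<lambda>x. span {?v x}) ` topspace (top_of_set ?S) = topspace RP3"
      using v0 by (auto simp: RP3_def)
  qed
  show ?thesis
  proof (rule homeomorphic_space_of_quotient_maps[OF quot_X quot_R])
    fix x y assume "x \<in> topspace (top_of_set ?S)" "y \<in> topspace (top_of_set ?S)"
    then have norm: "norm x = 1" "norm y = 1" by simp_all
    have "(?orb \<circ> framed_rot M) x = (?orb \<circ> framed_rot M) y \<longleftrightarrow>
        (\<exists>g\<in>binary_dihedral n. \<exists>h\<in>binary_dihedral n. y = g \<star> x \<star> h)"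
      using orbit_framed_rot_eq_iff[OF M D n0 dihedral_rotation_group_subgroup[OF assms(1)] norm] by simp
    also have "\<dots> \<longleftrightarrow> (\<exists>c. c \<noteq> 0 \<and> double_coset_inv n y = c *\<^sub>R double_coset_inv n x)"
      by (rule double_coset_inv_eq_iff[OF assms(2) norm, symmetric])
    also have "\<dots> \<longleftrightarrow> span {?v x} = span {?v y}"
      unfolding span_singleton_eq_iff[OF v0[OF norm(1)] v0[OF norm(2)]] by (simp add: inj flip: scale)
    finally show "(?orb \<circ> framed_rot M) x = (?orb \<circ> framed_rot M) y \<longleftrightarrow> span {?v x} = span {?v y}" .
  qed
qed

end
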